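(* Let $\mu_1,\mu_2$ be two probability measures on the Borel $\sigma$-field of the real line. For every real number $n>0$ there exists a Borel probability measure $\nu$ on $\mathbb{R}$ such that $$R_{2n}(u;\nu)=R_{n}(u;\mu_1)\,R_{n}(u;\mu_2)\qquad\text{for all } u\in\mathbb{R}.$$
   Context: For a Borel probability measure $\mu$ on $\mathbb{R}$ and a real number $\gamma>0$, the modified Stieltjes transform of $\mu$ with index $\gamma$ is $$R_{\gamma}(u;\mu)=\int_{-\infty}^{\infty}\frac{d\mu(x)}{(1-iux)^{\gamma}},\qquad u\in\mathbb{R},$$ where the power is taken with the principal branch (note that $1-iux$ has real part $1$ for real $u,x$). *)

theory Defs
  imports "HOL-Probability.Probability"
begin

(* The complex powr is exp (\<gamma> * Ln z) with Ln the principal branch for z \<noteq> 0; here Re z = 1.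
   The integrand is continuous and bounded by 1 in norm for \<gamma> > 0, hence Bochner integrable
   with respect to every real_distribution. *)
definition mod_stieltjes :: "real \<Rightarrow> real measure \<Rightarrow> real \<Rightarrow> complex" where
  "mod_stieltjes \<gamma> \<mu> u =
     (\<integral>x. 1 / (1 - \<i> * complex_of_real u * complex_of_real x) powr complex_of_real \<gamma> \<partial>\<mu>)"

end

theory Submission
  imports Defs
begin

text \<open>
  Let \<open>X\<close>, \<open>Y\<close> and \<open>T\<close> be independent, \<open>X\<close> and \<open>Y\<close> with the two given laws and \<open>T\<close> with the
  symmetric Beta law of parameters \<open>(n, n)\<close>. The measure sought is the law of the randomly weighted
  average \<open>T X + (1 - T) Y\<close>. By Fubini this reduces to constant \<open>X\<close> and \<open>Y\<close>, that is, to the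
  Feynman parametrisation, for \<open>a\<close> and \<open>b\<close> on the line \<open>Re z = 1\<close>,
  \<open>E [(T a + (1 - T) b) powr (-2n)] = a powr (-n) * b powr (-n)\<close>
  (lemma \<open>beta_average_line_pow\<close>). The function \<open>z \<mapsto> z powr (-2n)\<close> is applied
  only to points of that line, because the line is convex.

  The usual substitution proving Feynman's formula for positive reals would become a change of
  contour for complex \<open>a\<close> and \<open>b\<close>. Instead, \<open>a\<close> and \<open>b\<close> are moved from \<open>1\<close> along
  the segments \<open>a = 1 - \<i> s p\<close>, \<open>b = 1 - \<i> s q\<close> with \<open>0 \<le> s \<le> 1\<close>. With \<open>D = t a + (1 - t) b\<close>, the
  normalised integrand \<open>a powr n * b powr n * D powr (-2n)\<close> is identically \<open>1\<close> at \<open>s = 0\<close>, and its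
  Beta average does not depend on \<open>s\<close>: the \<open>s\<close>-derivative of the integrand is
  \<open>- \<i> (p - q) a powr (n - 1) * b powr (n - 1)\<close> times \<open>n ((1 - t) b - t a) D powr (-2n - 1)\<close>,
  and the latter, multiplied by the Beta weight, is the \<open>t\<close>-derivative of
  \<open>(t (1 - t)) powr n * D powr (-2n)\<close>, which vanishes at \<open>t = 0\<close> and \<open>t = 1\<close>.
\<close>

section \<open>Powers along the line of real part one\<close>

text \<open>
  All complex powers in the argument have a base \<open>1 - \<i> v\<close> with \<open>v\<close> real. Keeping \<open>v\<close> as
  the variable stays clear of the branch cut, which makes continuity, measurability and
  differentiability unconditional.
\<close>

definition line_pow :: "real \<Rightarrow> real \<Rightarrow> complex" where
  "line_pow c v = (1 - \<i> * complex_of_real v) powr complex_of_real c"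

lemma line_point_nonzero: "1 - \<i> * complex_of_real v \<noteq> 0"
  by (simp add: complex_eq_iff)

lemma line_pow_1: "line_pow 1 v = 1 - \<i> * complex_of_real v"
  by (simp add: line_pow_def powr_one')

lemma line_pow_at_0 [simp]: "line_pow c 0 = 1"
  by (simp add: line_pow_def)

lemma line_pow_add: "line_pow (a + b) v = line_pow a v * line_pow b v"
  by (simp add: line_pow_def powr_add)

lemma line_pow_uminus: "line_pow (- c) v = 1 / line_pow c v"
  by (simp add: line_pow_def powr_minus_divide)

lemma line_pow_nonzero: "line_pow c v \<noteq> 0"
  using line_point_nonzero by (simp add: line_pow_def)

lemma line_pow_has_vector_derivative [derivative_intros]:
  assumes "(f has_real_derivative f') (at x)"
  shows "((\<lambda>x. line_pow c (f x)) has_vector_derivative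
            (- \<i> * of_real (c * f') * line_pow (c - 1) (f x))) (at x)"
proof -
  have "((\<lambda>z. z powr of_real c) has_field_derivative
      of_real c * (1 - \<i> * of_real (f x)) powr (of_real c - 1)) (at (1 - \<i> * of_real (f x)))"
    by (intro has_field_derivative_powr) (auto simp: complex_nonpos_Reals_iff)
  moreover have "((\<lambda>x. 1 - \<i> * of_real (f x)) has_vector_derivative - \<i> * of_real f') (at x)"
    using assms by (auto intro!: derivative_eq_intros simp: has_real_derivative_iff_has_vector_derivative)
  ultimately show ?thesis
    unfolding line_pow_def using field_vector_diff_chain_at [unfolded o_def]
    by (fastforce simp: mult_ac)
qed

lemma continuous_on_line_pow [continuous_intros]:
  assumes "continuous_on S f"
  shows "continuous_on S (\<lambda>x. line_pow c (f x))"
  unfolding line_pow_def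
  by (intro continuous_intros assms) (auto simp: complex_eq_iff)

lemma measurable_line_pow [measurable]: "line_pow c \<in> borel_measurable borel"
  by (intro borel_measurable_continuous_onI continuous_intros)

lemma norm_line_pow_le_1:
  assumes "c \<le> 0"
  shows "norm (line_pow c v) \<le> 1"
proof -
  have "norm (line_pow c v) = norm (1 - \<i> * complex_of_real v) powr c"
    by (simp add: line_pow_def norm_powr_real_powr')
  moreover have "1 \<le> norm (1 - \<i> * complex_of_real v)"
    using complex_Re_le_cmod [of "1 - \<i> * complex_of_real v"] by simp
  ultimately show ?thesis
    using assms by (metis powr_one_eq_one powr_mono2' zero_less_one)
qed

lemma mod_stieltjes_line_pow: "mod_stieltjes \<gamma> \<mu> u = (\<integral>x. line_pow (- \<gamma>) (u * x) \<partial>\<mu>)"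
  unfolding line_pow_uminus by (simp add: mod_stieltjes_def line_pow_def mult.assoc)

section \<open>The symmetric Beta law\<close>

definition beta_weight :: "real \<Rightarrow> real \<Rightarrow> real" where
  "beta_weight n t = t powr (n - 1) * (1 - t) powr (n - 1)"

definition beta_measure :: "real \<Rightarrow> real measure" where
  "beta_measure n = density lborel (\<lambda>t. ennreal (indicator {0..1} t * beta_weight n t / Beta n n))"

lemma beta_weight_nonneg: "0 \<le> beta_weight n t"
  by (simp add: beta_weight_def)

lemma measurable_beta_weight [measurable]: "beta_weight n \<in> borel_measurable borel"
  unfolding beta_weight_def by measurable

lemma sets_beta_measure [simp, measurable_cong]: "sets (beta_measure n) = sets borel"
  by (simp add: beta_measure_def)

lemma space_beta_measure [simp]: "space (beta_measure n) = UNIV"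
  by (simp add: beta_measure_def)

lemma Beta_pos: "n > 0 \<Longrightarrow> 0 < Beta n (n::real)"
  by (simp add: Beta_def Gamma_real_pos)

lemma prob_space_beta_measure:
  assumes "n > 0"
  shows "prob_space (beta_measure n)"
proof
  have "((\<lambda>t. beta_weight n t / Beta n n) has_integral 1) {0..1}"
    using has_integral_divide [OF has_integral_Beta_real [OF assms assms], of "Beta n n"]
      Beta_pos [OF assms] by (simp add: beta_weight_def)
  then have "(\<integral>\<^sup>+ t. ennreal (beta_weight n t / Beta n n) * indicator {0..1} t \<partial>lborel) = ennreal 1"
    using Beta_pos [OF assms]
    by (intro nn_integral_has_integral_lebesgue') (auto simp: beta_weight_nonneg)
  also have "(\<integral>\<^sup>+ t. ennreal (beta_weight n t / Beta n n) * indicator {0..1} t \<partial>lborel) =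
      (\<integral>\<^sup>+ t. ennreal (indicator {0..1} t * beta_weight n t / Beta n n) \<partial>lborel)"
    by (intro nn_integral_cong) (auto simp: indicator_def)
  finally show "emeasure (beta_measure n) (space (beta_measure n)) = 1"
    by (simp add: beta_measure_def emeasure_density)
qed

lemma AE_beta_measure: "AE t in beta_measure n. t \<in> {0..1}"
  unfolding beta_measure_def by (subst AE_density) (auto simp: indicator_def)

text \<open>
  The antiderivative \<open>F\<close> has to be differentiable only inside the interval, since for \<open>n < 1\<close> the
  weight is singular at both endpoints. For \<open>n = 1\<close> the weight is \<open>1\<close> there and the lemma is the
  ordinary fundamental theorem of calculus on the unit interval; both cases are used below, so that
  both integrations are over probability measures.
\<close>
lemma integral_beta_measure_FTC:
  fixes f F :: "real \<Rightarrow> complex"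
  assumes n: "n > 0" and f: "continuous_on UNIV f" and F: "continuous_on {0..1} F"
    and deriv: "\<And>t. t \<in> {0<..<1} \<Longrightarrow> (F has_vector_derivative beta_weight n t *\<^sub>R f t) (at t)"
  shows "(\<integral>t. f t \<partial>beta_measure n) = (F 1 - F 0) / Beta n n"
proof -
  interpret prob_space "beta_measure n" using n by (rule prob_space_beta_measure)
  let ?w = "\<lambda>t. indicator {0..1} t * beta_weight n t / Beta n n"
  have [measurable]: "f \<in> borel_measurable borel"
    using f by (rule borel_measurable_continuous_onI)
  have w: "AE t in lborel. 0 \<le> ?w t"
    using Beta_pos [OF n] by (simp add: beta_weight_nonneg)
  have "compact (f ` {0..1})"
    using f continuous_on_subset by (intro compact_continuous_image) auto
  then obtain C where "\<And>t. t \<in> {0..1} \<Longrightarrow> norm (f t) \<le> C"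
    by (metis compact_imp_bounded bounded_iff imageI)
  then have "integrable (beta_measure n) f"
    using AE_beta_measure [of n] by (intro integrable_const_bound [of _ C]) auto
  then have int: "integrable lborel (\<lambda>t. ?w t *\<^sub>R f t)"
    unfolding beta_measure_def using w by (subst (asm) integrable_density) auto
  have "(\<lambda>t. ?w t *\<^sub>R f t) = (\<lambda>t. if t \<in> {0..1} then (beta_weight n t / Beta n n) *\<^sub>R f t else 0)"
    by auto
  with has_integral_integral_lborel [OF int] have "((\<lambda>t. if t \<in> {0..1} then (beta_weight n t / Beta n n) *\<^sub>R f t else 0)
      has_integral (\<integral>t. ?w t *\<^sub>R f t \<partial>lborel)) UNIV"
    by metis
  then have "((\<lambda>t. (beta_weight n t / Beta n n) *\<^sub>R f t) has_integral
      (\<integral>t. ?w t *\<^sub>R f t \<partial>lborel)) {0..1}"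
    by (simp only: has_integral_restrict_UNIV)
  moreover have "(\<integral>t. ?w t *\<^sub>R f t \<partial>lborel) = (\<integral>t. f t \<partial>beta_measure n)"
    unfolding beta_measure_def using w by (subst integral_density) auto
  ultimately have 1: "((\<lambda>t. (beta_weight n t / Beta n n) *\<^sub>R f t) has_integral
      (\<integral>t. f t \<partial>beta_measure n)) {0..1}"
    by simp
  have "((\<lambda>t. beta_weight n t *\<^sub>R f t) has_integral (F 1 - F 0)) {0..1}"
    using F deriv by (intro fundamental_theorem_of_calculus_interior) auto
  from has_integral_divide [OF this, of "of_real (Beta n n)"]
  have 2: "((\<lambda>t. (beta_weight n t / Beta n n) *\<^sub>R f t) has_integral
      ((F 1 - F 0) / Beta n n)) {0..1}"
    by (simp add: scaleR_conv_of_real)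
  from 1 2 show ?thesis by (rule has_integral_unique)
qed

section \<open>The Feynman parametrisation\<close>

text \<open>
  The derivative of the normalised integrand \<open>h s t\<close> with respect to \<open>s\<close> is integrated over the unit
  square, uniformly in \<open>s\<close> and with the Beta law in \<open>t\<close>. Integrating over \<open>s\<close> first gives the increment
  of the average of \<open>h s\<close> between \<open>s = 0\<close> and \<open>s = 1\<close>; integrating over \<open>t\<close> first gives zero. Using
  Fubini here avoids differentiating under an integral whose weight is singular.
\<close>
lemma beta_average_line_pow:
  fixes n p q :: real
  assumes n: "n > 0"
  shows "(\<integral>t. line_pow (- (2 * n)) (t * p + (1 - t) * q) \<partial>beta_measure n)
           = line_pow (- n) p * line_pow (- n) q"
proof -
  interpret U: prob_space "beta_measure 1" by (rule prob_space_beta_measure) simp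
  interpret B: prob_space "beta_measure n" using n by (rule prob_space_beta_measure)
  interpret UB: pair_prob_space "beta_measure 1" "beta_measure n" ..
  define z where "z t = t * p + (1 - t) * q" for t
  define h where "h s t = line_pow n (s * p) * line_pow n (s * q) * line_pow (- (2 * n)) (s * z t)"
    for s t
  define c where "c s = - \<i> * of_real (p - q) * line_pow (n - 1) (s * p) * line_pow (n - 1) (s * q)"
    for s
  define k where "k s t = of_real n * line_pow (- (2 * n) - 1) (s * z t) *
      (of_real (1 - t) * line_pow 1 (s * q) - of_real t * line_pow 1 (s * p))" for s t
  \<comment> \<open>Lowering each exponent by one leaves polynomial identities for the two derivatives.\<close>
  have step: "line_pow n v = line_pow (n - 1) v * line_pow 1 v"
    "line_pow (- (2 * n)) v = line_pow (- (2 * n) - 1) v * line_pow 1 v" for v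
    by (simp_all flip: line_pow_add)

  \<comment> \<open>The \<open>s\<close>-derivative splits off a factor \<open>c s\<close> that is constant in \<open>t\<close>.\<close>
  have ds: "((\<lambda>s. h s t) has_vector_derivative c s * k s t) (at s)" for s t
    unfolding h_def
    apply (rule has_vector_derivative_eq_rhs)
     apply (rule derivative_intros has_vector_derivative_mult DERIV_cmult_right DERIV_ident)+
    unfolding step k_def c_def
    apply (simp add: line_pow_1 z_def)
    apply algebra
    done

  have dt: "((\<lambda>t. of_real ((t * (1 - t)) powr n) * line_pow (- (2 * n)) (s * z t))
        has_vector_derivative beta_weight n t *\<^sub>R k s t) (at t)" if t: "t \<in> {0<..<1}" for s t
  proof -
    have A: "((\<lambda>t. (t * (1 - t)) powr n) has_real_derivative n * (t * (1 - t)) powr (n - 1) * (1 - 2 * t)) (at t)"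
      using t by (auto intro!: derivative_eq_intros simp: powr_diff field_simps)
    have w: "beta_weight n t = (t * (1 - t)) powr (n - 1)"
      using t by (simp add: beta_weight_def powr_mult)
    have w': "(t * (1 - t)) powr n = t * (1 - t) * beta_weight n t"
      using t by (simp add: w powr_diff)
    have B: "((\<lambda>t. s * z t) has_real_derivative s * (p - q)) (at t)"
      unfolding z_def by (auto intro!: derivative_eq_intros simp: algebra_simps)
    show ?thesis
      apply (rule has_vector_derivative_eq_rhs)
       apply (rule has_vector_derivative_mult has_vector_derivative_of_real line_pow_has_vector_derivative A B
          A [unfolded has_real_derivative_iff_has_vector_derivative])+
      unfolding step k_def w' w [symmetric]
      apply (simp add: line_pow_1 z_def scaleR_conv_of_real)
      apply algebra
      done
  qed

  have cont: "continuous_on UNIV (\<lambda>t. k s t)" "continuous_on UNIV (\<lambda>s. c s * k s t)" for s t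
    unfolding k_def c_def z_def by (intro continuous_intros)+
  have inner_s: "(\<integral>s. c s * k s t \<partial>beta_measure 1) = h 1 t - h 0 t" for t
  proof -
    have "continuous_on {0..1} (\<lambda>s. h s t)"
      unfolding h_def by (intro continuous_intros)
    moreover have "((\<lambda>s. h s t) has_vector_derivative beta_weight 1 s *\<^sub>R (c s * k s t)) (at s)"
      if "s \<in> {0<..<1}" for s
      using ds that by (simp add: beta_weight_def)
    ultimately show ?thesis
      using integral_beta_measure_FTC [OF _ cont(2)] by (simp add: Beta_def Gamma_numeral)
  qed
  have inner_t: "(\<integral>t. c s * k s t \<partial>beta_measure n) = 0" for s
  proof -
    have "continuous_on {0..1} (\<lambda>t. of_real ((t * (1 - t)) powr n) * line_pow (- (2 * n)) (s * z t))"
      unfolding z_def using n by (intro continuous_intros continuous_on_powr') auto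
    from integral_beta_measure_FTC [OF n cont(1) this dt]
    show ?thesis by simp
  qed

  have "continuous_on ({0..1} \<times> {0..1}) (\<lambda>(s, t). c s * k s t)"
    unfolding c_def k_def z_def case_prod_beta by (intro continuous_intros)
  then have "bounded ((\<lambda>(s, t). c s * k s t) ` ({0..1} \<times> {0..1}))"
    by (intro compact_imp_bounded compact_continuous_image compact_Times) auto
  then obtain C where "\<forall>x \<in> (\<lambda>(s, t). c s * k s t) ` ({0..1} \<times> {0..1}). norm x \<le> C"
    unfolding bounded_iff by blast
  then have C: "norm (c s * k s t) \<le> C" if "s \<in> {0..1}" "t \<in> {0..1}" for s t
    using that by force
  have [measurable]: "(\<lambda>(s, t). c s * k s t) \<in> borel_measurable (beta_measure 1 \<Otimes>\<^sub>M beta_measure n)"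
    unfolding c_def k_def z_def by measurable
  have "AE x in beta_measure 1 \<Otimes>\<^sub>M beta_measure n. norm (case x of (s, t) \<Rightarrow> c s * k s t) \<le> C"
  proof (rule UB.AE_pair_measure)
    show "AE s in beta_measure 1. AE t in beta_measure n. norm (case (s, t) of (s, t) \<Rightarrow> c s * k s t) \<le> C"
      using AE_beta_measure [of 1]
    proof eventually_elim
      case (elim s)
      show ?case using AE_beta_measure [of n] by eventually_elim (use elim C in simp)
    qed
  qed measurable
  then have int: "integrable (beta_measure 1 \<Otimes>\<^sub>M beta_measure n) (\<lambda>(s, t). c s * k s t)"
    by (intro UB.integrable_const_bound) auto

  have "(\<integral>t. h 1 t - h 0 t \<partial>beta_measure n) = (\<integral>t. \<integral>s. c s * k s t \<partial>beta_measure 1 \<partial>beta_measure n)"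
    by (simp add: inner_s)
  also have "\<dots> = (\<integral>s. \<integral>t. c s * k s t \<partial>beta_measure n \<partial>beta_measure 1)"
    using int by (rule UB.Fubini_integral)
  also have "\<dots> = 0"
    by (simp only: inner_t integral_zero)
  finally have "(\<integral>t. h 1 t - h 0 t \<partial>beta_measure n) = 0" .
  moreover have h0: "h 0 t = 1" for t
    by (simp add: h_def)
  moreover have int_pow: "integrable (beta_measure n) (\<lambda>t. line_pow (- (2 * n)) (z t))"
    unfolding z_def using n norm_line_pow_le_1 by (intro B.integrable_const_bound [of _ 1]) auto
  moreover from int_pow have "integrable (beta_measure n) (h 1)"
    unfolding h_def by simp
  ultimately have "(\<integral>t. h 1 t \<partial>beta_measure n) = 1"
    by (simp add: B.prob_space [simplified])
  then have "line_pow n p * line_pow n q * (\<integral>t. line_pow (- (2 * n)) (z t) \<partial>beta_measure n) = 1"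
    unfolding h_def by simp
  then show ?thesis
    using line_pow_nonzero [of n] by (simp add: z_def line_pow_uminus [of n] field_simps)
qed

section \<open>Random averages multiply the transforms\<close>

theorem theorem2p1:
  fixes \<mu>\<^sub>1 \<mu>\<^sub>2 :: "real measure" and n :: real
  assumes "real_distribution \<mu>\<^sub>1" and "real_distribution \<mu>\<^sub>2" and "n > 0"
  shows "\<exists>\<nu> :: real measure. real_distribution \<nu> \<and>
           (\<forall>u :: real. mod_stieltjes (2 * n) \<nu> u = mod_stieltjes n \<mu>\<^sub>1 u * mod_stieltjes n \<mu>\<^sub>2 u)"
proof -
  interpret M1: real_distribution \<mu>\<^sub>1 by fact
  interpret M2: real_distribution \<mu>\<^sub>2 by fact
  interpret B: prob_space "beta_measure n" using \<open>n > 0\<close> by (rule prob_space_beta_measure)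
  interpret M2B: pair_prob_space \<mu>\<^sub>2 "beta_measure n" ..
  interpret P: pair_prob_space \<mu>\<^sub>1 "\<mu>\<^sub>2 \<Otimes>\<^sub>M beta_measure n" ..
  define mix :: "real \<times> real \<times> real \<Rightarrow> real" where "mix = (\<lambda>(x, y, t). t * x + (1 - t) * y)"
  let ?P = "\<mu>\<^sub>1 \<Otimes>\<^sub>M (\<mu>\<^sub>2 \<Otimes>\<^sub>M beta_measure n)"
  have mix [measurable]: "mix \<in> borel_measurable ?P"
    unfolding mix_def by measurable
  have "mod_stieltjes (2 * n) (distr ?P borel mix) u = mod_stieltjes n \<mu>\<^sub>1 u * mod_stieltjes n \<mu>\<^sub>2 u" for u
  proof -
    have eq: "u * mix (x, y, t) = t * (u * x) + (1 - t) * (u * y)" for x y t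
      by (simp add: mix_def algebra_simps)
    have int: "integrable ?P (\<lambda>w. line_pow (- (2 * n)) (u * mix w))"
      using \<open>n > 0\<close> by (intro P.integrable_const_bound [of _ 1] AE_I2 norm_line_pow_le_1) auto
    have int': "integrable (\<mu>\<^sub>2 \<Otimes>\<^sub>M beta_measure n) (\<lambda>w. line_pow (- (2 * n)) (u * mix (x, w)))" for x
      using \<open>n > 0\<close> unfolding mix_def
      by (intro M2B.integrable_const_bound [of _ 1] AE_I2 norm_line_pow_le_1) auto
    have "mod_stieltjes (2 * n) (distr ?P borel mix) u = (\<integral>w. line_pow (- (2 * n)) (u * mix w) \<partial>?P)"
      unfolding mod_stieltjes_line_pow by (rule integral_distr) measurable
    also have "\<dots> = (\<integral>x. \<integral>w. line_pow (- (2 * n)) (u * mix (x, w)) \<partial>(\<mu>\<^sub>2 \<Otimes>\<^sub>M beta_measure n) \<partial>\<mu>\<^sub>1)"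
      using P.integral_fst' [OF int] by simp
    also have "\<dots> = (\<integral>x. \<integral>y. \<integral>t. line_pow (- (2 * n)) (u * mix (x, y, t)) \<partial>beta_measure n \<partial>\<mu>\<^sub>2 \<partial>\<mu>\<^sub>1)"
      using M2B.integral_fst' [OF int'] by simp
    also have "\<dots> = (\<integral>x. \<integral>y. line_pow (- n) (u * x) * line_pow (- n) (u * y) \<partial>\<mu>\<^sub>2 \<partial>\<mu>\<^sub>1)"
      unfolding eq using \<open>n > 0\<close> by (simp add: beta_average_line_pow)
    also have "\<dots> = mod_stieltjes n \<mu>\<^sub>1 u * mod_stieltjes n \<mu>\<^sub>2 u"
      by (simp add: mod_stieltjes_line_pow)
    finally show ?thesis .
  qed
  moreover have "real_distribution (distr ?P borel mix)"
    by (rule P.real_distribution_distr) measurable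
  ultimately show ?thesis by blast
qed

end
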